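(* Let $X$ be a finite set with $|X|=n$, and let $a\in\mathcal T_X$ be an idempotent with $r=\operatorname{rank}(a)$, where $1<r<n$. Let $\mathcal E_X^a$ be the subsemigroup of $\mathcal T_X^a$ generated by all idempotents of $\mathcal T_X^a$. Then $$\operatorname{rank}(\mathcal E_X^a)=\operatorname{idrank}(\mathcal E_X^a)=r^{n-r}+\rho_r,$$ where $\rho_2=2$ and $\rho_r=\binom r2$ if $r\ge3$.
   Context: $\mathcal T_X$ is the full transformation semigroup of all maps $X\to X$ under composition; maps are written on the right and composed from left to right; for $f\in\mathcal T_X$, $\operatorname{rank}(f)=|\operatorname{im}(f)|$. The variant $\mathcal T_X^a$ is the semigroup with underlying set $\mathcal T_X$ and operation $f\star g=fag$. For a semigroup $S$, $\operatorname{rank}(S)$ is the least cardinality of a subset generating $S$ as a semigroup; if $S$ is generated by its idempotents, $\operatorname{idrank}(S)$ is the least cardinality of a set of idempotents generating $S$. *)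

theory Defs
  imports Complex_Main "HOL-Library.Cardinality"
begin

text \<open>
  A semigroup is given by a carrier set and a binary operation. Generation is semigroup
  generation: only nonempty products are formed, and no identity is adjoined.
\<close>

inductive_set sg_gen :: "('s \<Rightarrow> 's \<Rightarrow> 's) \<Rightarrow> 's set \<Rightarrow> 's set"
  for m :: "'s \<Rightarrow> 's \<Rightarrow> 's" and A :: "'s set" where
  base: "s \<in> A \<Longrightarrow> s \<in> sg_gen m A"
| mult: "s \<in> sg_gen m A \<Longrightarrow> t \<in> sg_gen m A \<Longrightarrow> m s t \<in> sg_gen m A"

definition idems :: "('s \<Rightarrow> 's \<Rightarrow> 's) \<Rightarrow> 's set \<Rightarrow> 's set" where
  "idems m S = {e \<in> S. m e e = e}"

text \<open>
  The two ranks are natural numbers, so they are meaningful for finitely generated semigroups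
  (in particular for finite ones), and the second one only for semigroups that are generated by
  finitely many idempotents.
\<close>

definition sg_rank :: "('s \<Rightarrow> 's \<Rightarrow> 's) \<Rightarrow> 's set \<Rightarrow> nat" where
  "sg_rank m S = (LEAST k. \<exists>A. A \<subseteq> S \<and> finite A \<and> card A = k \<and> sg_gen m A = S)"

definition sg_idrank :: "('s \<Rightarrow> 's \<Rightarrow> 's) \<Rightarrow> 's set \<Rightarrow> nat" where
  "sg_idrank m S = (LEAST k. \<exists>A. A \<subseteq> idems m S \<and> finite A \<and> card A = k \<and> sg_gen m A = S)"

text \<open>
  The set \<open>X\<close> is the universe of a type \<open>'x\<close>, so \<open>\<T>\<^sub>X\<close> is the universe of \<open>'x \<Rightarrow> 'x\<close>. Maps are
  written on the right, so the product \<open>fg\<close> means: first \<open>f\<close>, then \<open>g\<close>.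
\<close>

definition trans_mult :: "('x \<Rightarrow> 'x) \<Rightarrow> ('x \<Rightarrow> 'x) \<Rightarrow> 'x \<Rightarrow> 'x" where
  "trans_mult f g = g \<circ> f"

definition trans_rank :: "('x \<Rightarrow> 'x) \<Rightarrow> nat" where
  "trans_rank f = card (range f)"

definition variant_mult :: "('x \<Rightarrow> 'x) \<Rightarrow> ('x \<Rightarrow> 'x) \<Rightarrow> ('x \<Rightarrow> 'x) \<Rightarrow> 'x \<Rightarrow> 'x" where
  "variant_mult a f g = trans_mult (trans_mult f a) g"

definition idem_gen_variant :: "('x \<Rightarrow> 'x) \<Rightarrow> ('x \<Rightarrow> 'x) set" where
  "idem_gen_variant a = sg_gen (variant_mult a) (idems (variant_mult a) UNIV)"

text \<open>Only the values at \<open>r \<ge> 2\<close> are used.\<close>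

definition rho :: "nat \<Rightarrow> nat" where
  "rho r = (if r = 2 then 2 else r choose 2)"

end

theory Submission
  imports Defs "HOL-Library.FuncSet"
begin

text \<open>
  Write \<open>A\<close> for the image of \<open>a\<close>, so \<open>|A| = r\<close> and \<open>a\<close> fixes \<open>A\<close> pointwise. The map \<open>f \<mapsto> (a \<circ> f)|\<^sub>A\<close>
  is a homomorphism from the variant to the full transformation semigroup on \<open>A\<close>. It sends an
  idempotent either to the identity or to a non-injective map, so the same holds for every element
  of the idempotent-generated subsemigroup \<open>E\<close> (\<open>idem_gen_inj_imp_id\<close>).

  \<^emph>\<open>Lower bound.\<close> Let \<open>G\<close> generate \<open>E\<close>. A product acts as the identity on \<open>A\<close> only if all its
  factors do, and then \<open>a \<circ> f\<close> is determined by the first factor. Every retraction \<open>p\<close> of \<open>X\<close> onto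
  \<open>A\<close> is an idempotent of the variant with \<open>a \<circ> p = p\<close>, so \<open>G\<close> has at least one element acting as
  the identity on \<open>A\<close> for each of the \<open>r ^ (n - r)\<close> retractions. If a product identifies exactly
  two points of \<open>A\<close>, then so does its first factor that is not the identity on \<open>A\<close>; hence \<open>G\<close> has a
  further element for each of the \<open>r choose 2\<close> pairs. For \<open>r = 2\<close> there are two constant maps on
  \<open>A\<close>, and each must come from a generator, because the last non-identity factor determines the
  image.

  \<^emph>\<open>Upper bound.\<close> Every idempotent \<open>f\<close> of the variant factors as \<open>s \<circ> t \<circ> p\<close> with \<open>p\<close> a retraction
  onto \<open>A\<close>, \<open>s\<close> a section of \<open>a\<close>, and \<open>t = a \<circ> f \<circ> a\<close> idempotent (\<open>idem_factorization\<close>). The maps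
  \<open>s \<circ> p\<close> form a rectangular band of idempotents. There are at least as many retractions as
  sections, the latter taken up to their values on \<open>A\<close> (\<open>section_of_surj\<close>), so \<open>r ^ (n - r)\<close> of these maps suffice to generate the band. The
  idempotent \<open>t\<close> is a product of maps \<open>e\<^sub>i\<^sub>j\<close> moving the single point \<open>i\<close> of \<open>A\<close> to \<open>j\<close>
  (\<open>idem_by_collapses\<close>). Finally \<open>e\<^sub>i\<^sub>j = (e\<^sub>j\<^sub>i e\<^sub>k\<^sub>j e\<^sub>i\<^sub>k)\<^sup>2\<close>, a product read from left to
  right (\<open>reverse_arc\<close>), so for \<open>r \<ge> 3\<close> it is enough to take one
  of \<open>e\<^sub>i\<^sub>j\<close>, \<open>e\<^sub>j\<^sub>i\<close> for each pair, oriented as a suitable tournament in which the missing arcs can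
  be completed through 3-cycles.
\<close>

section \<open>Generated subsemigroups\<close>

lemma sg_gen_subset:
  assumes "A \<subseteq> sg_gen m B"
  shows "sg_gen m A \<subseteq> sg_gen m B"
proof
  fix x assume "x \<in> sg_gen m A"
  then show "x \<in> sg_gen m B"
    by induction (use assms in \<open>auto intro: sg_gen.mult\<close>)
qed

lemma rank_and_idrank_eqI:
  assumes gen: "B \<subseteq> idems m S" "finite B" "sg_gen m B = S" "card B \<le> N"
    and lower: "\<And>G. finite G \<Longrightarrow> sg_gen m G = S \<Longrightarrow> N \<le> card G"
  shows "sg_rank m S = N" "sg_idrank m S = N"
proof -
  have B: "card B = N" using gen lower[of B] by simp
  have "B \<subseteq> S" using gen(1) by (auto simp: idems_def)
  then show "sg_rank m S = N" unfolding sg_rank_def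
    by (intro Least_equality) (use gen B lower in blast)+
  show "sg_idrank m S = N" unfolding sg_idrank_def
    by (intro Least_equality) (use gen B lower in blast)+
qed

section \<open>Retractions and sections of an idempotent map\<close>

locale idempotent_map =
  fixes a :: "'x::finite \<Rightarrow> 'x"
  assumes a_a [simp]: "a (a x) = a x"
begin

lemma star_eq: "variant_mult a f g = (\<lambda>x. g (a (f x)))"
  by (auto simp: variant_mult_def trans_mult_def)

lemma mem_range_iff: "y \<in> range a \<longleftrightarrow> a y = y"
  by (metis a_a rangeE rangeI)

abbreviation idempotents :: "('x \<Rightarrow> 'x) set" where
  "idempotents \<equiv> idems (variant_mult a) UNIV"

lemma mem_idempotents: "f \<in> idempotents \<longleftrightarrow> (\<forall>x. f (a (f x)) = f x)"
  by (auto simp: idems_def star_eq fun_eq_iff)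

definition retractions :: "('x \<Rightarrow> 'x) set" where
  "retractions = {p. \<forall>x. a (p x) = p x \<and> p (a x) = a x}"

text \<open>
  Only the restriction of a section to the image of \<open>a\<close> matters; its other values are arbitrary.
\<close>
definition sections :: "('x \<Rightarrow> 'x) set" where
  "sections = {s. \<forall>x. a (s (a x)) = a x}"

lemma card_retractions:
  "card retractions = card (range a) ^ (CARD('x) - card (range a))"
proof -
  have "bij_betw (\<lambda>p. restrict p (- range a)) retractions ((- range a) \<rightarrow>\<^sub>E range a)"
  proof (rule bij_betwI[where g = "\<lambda>q x. if x \<in> range a then x else q x"])
    show "(\<lambda>p. restrict p (- range a)) \<in> retractions \<rightarrow> (- range a) \<rightarrow>\<^sub>E range a"
      by (auto simp: retractions_def) (metis rangeI)
    show "(\<lambda>q x. if x \<in> range a then x else q x)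
        \<in> ((- range a) \<rightarrow>\<^sub>E range a) \<rightarrow> retractions"
      by (auto simp: retractions_def PiE_iff mem_range_iff)
    fix p assume "p \<in> retractions"
    then show "(\<lambda>x. if x \<in> range a then x else restrict p (- range a) x) = p"
      by (auto simp: retractions_def fun_eq_iff)
  next
    fix q assume "q \<in> (- range a) \<rightarrow>\<^sub>E range a"
    then show "restrict (\<lambda>x. if x \<in> range a then x else q x) (- range a) = q"
      by (auto simp: fun_eq_iff PiE_iff extensional_def)
  qed
  then have "card retractions = card ((- range a) \<rightarrow>\<^sub>E range a)"
    by (rule bij_betw_same_card)
  then show ?thesis
    by (simp add: card_funcsetE Compl_eq_Diff_UNIV card_Diff_subset)
qed

lemma retractionD:
  assumes "p \<in> retractions"
  shows "a (p x) = p x" "p (a x) = a x" "p (p x) = p x"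
proof -
  show 1: "a (p x) = p x" "p (a x) = a x" for x
    using assms by (simp_all add: retractions_def)
  show "p (p x) = p x" using 1(2)[of "p x"] by (simp only: 1(1))
qed

lemma section_retraction:
  assumes "s \<in> sections" "p \<in> retractions"
  shows "a (s (p x)) = p x"
proof -
  have "a (s (a (p x))) = a (p x)" using assms(1) by (simp add: sections_def)
  then show ?thesis by (simp only: retractionD[OF assms(2)])
qed

lemma retraction_idempotent: "p \<in> retractions \<Longrightarrow> p \<in> idempotents"
  by (simp add: mem_idempotents retractionD)

lemma section_retraction_idempotent:
  "s \<in> sections \<Longrightarrow> p \<in> retractions \<Longrightarrow> s \<circ> p \<in> idempotents"
  by (simp add: mem_idempotents section_retraction retractionD)

text \<open>
  Here \<open>p\<close> agrees with \<open>a \<circ> f\<close> off \<open>A\<close>, and \<open>s\<close> lifts each point of \<open>A\<close> fixed by \<open>a \<circ> f\<close> back to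
  the image of \<open>f\<close>.
\<close>
lemma idem_factorization:
  assumes "f \<in> idempotents"
  obtains p s where "p \<in> retractions" "s \<in> sections" "f = s \<circ> (a \<circ> f \<circ> a) \<circ> p"
proof
  have f: "f (a (f x)) = f x" for x using assms by (simp add: mem_idempotents)
  define p where "p x = (if a x = x then x else a (f x))" for x
  define s where "s y = (if a (f y) = y then f y else y)" for y
  show "p \<in> retractions" by (simp add: p_def retractions_def)
  show "s \<in> sections" by (simp add: s_def sections_def)
  show "f = s \<circ> (a \<circ> f \<circ> a) \<circ> p" by (auto simp: p_def s_def f fun_eq_iff)
qed

text \<open>
  A map from retractions to sections. The retraction \<open>p\<close> marks a point outside the image by
  disagreeing with \<open>a\<close> there; the section picks a marked point in each fibre that has one, and the
  fixed point of \<open>a\<close> in the other fibres.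
\<close>
definition section_of :: "('x \<Rightarrow> 'x) \<Rightarrow> 'x \<Rightarrow> 'x" where
  "section_of p y = (if \<exists>x. a x = y \<and> p x \<noteq> y then SOME x. a x = y \<and> p x \<noteq> y else y)"

lemma section_of_mem: "section_of p \<in> sections"
proof -
  have "a (section_of p (a x)) = a x" for x
  proof (cases "\<exists>z. a z = a x \<and> p z \<noteq> a x")
    case True
    from someI_ex[OF this] show ?thesis using True by (simp add: section_of_def)
  qed (auto simp: section_of_def)
  then show ?thesis by (simp add: sections_def)
qed

lemma section_of_surj:
  assumes "1 < card (range a)" "s \<in> sections"
  obtains p where "p \<in> retractions" "\<And>x. section_of p (a x) = s (a x)"
proof -
  have s: "a (s (a x)) = a x" for x using assms(2) by (simp add: sections_def)
  have "\<exists>z. a z = z \<and> z \<noteq> y" for y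
  proof (rule ccontr)
    assume "\<not> ?thesis"
    then have "range a \<subseteq> {y}" by auto
    then have "card (range a) \<le> card {y}" by (intro card_mono) auto
    with assms(1) show False by simp
  qed
  then obtain \<sigma> where \<sigma>: "a (\<sigma> y) = \<sigma> y" "\<sigma> y \<noteq> y" for y by metis
  \<comment> \<open>The unique point of each fibre chosen by \<open>s\<close> is marked, unless it lies in the image of \<open>a\<close>.\<close>
  define p where "p x = (if a x \<noteq> x \<and> s (a x) = x then \<sigma> (a x) else a x)" for x
  show ?thesis
  proof
    show "p \<in> retractions" by (simp add: p_def retractions_def \<sigma>)
    fix x
    have marked: "a z = a x \<and> p z \<noteq> a x \<longleftrightarrow> z = s (a x) \<and> a z \<noteq> z" for z
      using s[of x] by (auto simp: p_def \<sigma>)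
    show "section_of p (a x) = s (a x)"
    proof (cases "a (s (a x)) = s (a x)")
      case True
      then show ?thesis using s[of x] by (auto simp: section_of_def marked)
    next
      case False
      then have "(SOME z. z = s (a x) \<and> a z \<noteq> z) = s (a x)" by (intro some_equality) auto
      with False show ?thesis by (auto simp: section_of_def marked)
    qed
  qed
qed

section \<open>The lower bound\<close>

text \<open>
  The points of \<open>A\<close> that \<open>a \<circ> f\<close> identifies with some other point of \<open>A\<close>.
\<close>
definition collisions :: "('x \<Rightarrow> 'x) \<Rightarrow> 'x set" where
  "collisions f = {x \<in> range a. \<exists>y \<in> range a. y \<noteq> x \<and> a (f x) = a (f y)}"

text \<open>The maps \<open>f\<close> for which \<open>a \<circ> f\<close> is the identity on \<open>A\<close>.\<close>
definition fixing :: "('x \<Rightarrow> 'x) set" where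
  "fixing = {f. \<forall>x. a (f (a x)) = a x}"

lemma collisions_empty_iff: "collisions f = {} \<longleftrightarrow> inj_on (a \<circ> f) (range a)"
proof -
  have "{x \<in> R. \<exists>y \<in> R. y \<noteq> x \<and> a (f x) = a (f y)} = {} \<longleftrightarrow> inj_on (a \<circ> f) R" for R
    by (auto simp: inj_on_def)
  then show ?thesis by (simp only: collisions_def)
qed

lemma collisions_two:
  assumes "x \<in> collisions f"
  shows "\<exists>y \<in> collisions f. y \<noteq> x"
proof -
  obtain y where y: "x \<in> range a" "y \<in> range a" "y \<noteq> x" "a (f x) = a (f y)"
    using assms by (simp only: collisions_def mem_Collect_eq) blast
  then have "y \<in> collisions f"
    by (simp only: collisions_def mem_Collect_eq) metis
  with y(3) show ?thesis ..
qed

text \<open>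
  An idempotent of the variant induces an idempotent map on \<open>A\<close>, which is the identity if it is
  injective; the property passes to products.
\<close>
lemma idem_gen_inj_imp_id:
  assumes "f \<in> idem_gen_variant a" "collisions f = {}"
  shows "f \<in> fixing"
  using assms unfolding idem_gen_variant_def
proof (induction f)
  case (base f)
  then have f: "f (a (f x)) = f x" and inj: "inj_on (a \<circ> f) (range a)" for x
    by (auto simp: mem_idempotents collisions_empty_iff)
  have "a (f (a x)) = a x" for x
    by (rule inj_onD[OF inj]) (auto simp: f)
  then show ?case by (simp add: fixing_def)
next
  case (mult g h)
  have "collisions g \<subseteq> collisions (variant_mult a g h)"
    by (force simp: collisions_def star_eq)
  with mult have g: "g \<in> fixing" by simp
  then have "collisions h = collisions (variant_mult a g h)"
    by (auto simp: collisions_def star_eq fixing_def)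
  with mult g show ?case by (auto simp: fixing_def star_eq)
qed

text \<open>In \<open>E\<close>, a product belongs to \<open>fixing\<close> only if both factors do.\<close>
lemma fixing_factors:
  assumes "g \<in> idem_gen_variant a" "h \<in> idem_gen_variant a" "variant_mult a g h \<in> fixing"
  shows "g \<in> fixing" "h \<in> fixing"
proof -
  have gh: "a (h (a (g (a x)))) = a x" for x
    using assms(3) by (simp add: fixing_def star_eq)
  have "inj_on (a \<circ> g) (range a)"
    by (rule inj_on_inverseI[where g = "a \<circ> h"]) (auto simp: gh)
  then have "collisions g = {}" by (simp only: collisions_empty_iff)
  with assms(1) show g: "g \<in> fixing" by (rule idem_gen_inj_imp_id)
  then show "h \<in> fixing" using gh by (simp add: fixing_def)
qed

context
  fixes G :: "('x \<Rightarrow> 'x) set"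
  assumes G: "sg_gen (variant_mult a) G = idem_gen_variant a"
begin

lemma generator_over_retraction:
  assumes "f \<in> sg_gen (variant_mult a) G" "f \<in> fixing"
  shows "\<exists>g \<in> G \<inter> fixing. a \<circ> g = a \<circ> f"
  using assms
proof (induction f)
  case (mult g h)
  then have "g \<in> fixing" "h \<in> fixing" using fixing_factors G by blast+
  moreover from this have "a \<circ> variant_mult a g h = a \<circ> g"
    by (auto simp: star_eq fixing_def fun_eq_iff)
  ultimately show ?case using mult.IH(1) by simp
qed blast

lemma generator_over_pair:
  assumes "f \<in> sg_gen (variant_mult a) G" "collisions f = {i, j}"
  shows "\<exists>g \<in> G - fixing. collisions g = {i, j}"
  using assms
proof (induction f)
  case (base f)
  have "collisions f = {}" if "f \<in> fixing"
    using that by (auto simp: collisions_def fixing_def)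
  with base show ?case by auto
next
  case (mult g h)
  have sub: "collisions g \<subseteq> {i, j}"
    using mult.prems by (force simp: collisions_def star_eq)
  show ?case
  proof (cases "collisions g = {}")
    case True
    then have "g \<in> fixing" using mult.hyps(1) idem_gen_inj_imp_id G by blast
    then have "collisions h = collisions (variant_mult a g h)"
      by (auto simp: collisions_def star_eq fixing_def)
    then show ?thesis using mult by simp
  next
    case False
    then obtain x y where "x \<in> collisions g" "y \<in> collisions g" "x \<noteq> y"
      using collisions_two by blast
    with sub have "collisions g = {i, j}" by auto
    then show ?thesis by (rule mult.IH(1))
  qed
qed

lemma generator_over_constant:
  assumes "card (range a) = 2"
    and "f \<in> sg_gen (variant_mult a) G" "(a \<circ> f) ` range a = {c}"
  shows "\<exists>g \<in> G - fixing. (a \<circ> g) ` range a = {c}"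
  using assms(2,3)
proof (induction f)
  case (base f)
  have "f \<notin> fixing"
  proof
    assume "f \<in> fixing"
    then have "(a \<circ> f) ` range a = range a" by (force simp: fixing_def)
    with base.prems have "range a = {c}" by (metis (no_types))
    then have "card (range a) = 1" by (metis is_singletonI is_singleton_altdef)
    with assms(1) show False by (metis numeral_eq_one_iff semiring_norm(85))
  qed
  with base show ?case by blast
next
  case (mult g h)
  have img: "(a \<circ> h) ` (a \<circ> g) ` range a = {c}"
    using mult.prems by (simp add: star_eq image_image)
  show ?case
  proof (cases "h \<in> fixing")
    case True
    then have "(a \<circ> g) ` range a = (a \<circ> h) ` (a \<circ> g) ` range a"
      by (auto simp: fixing_def image_image)
    then show ?thesis using img mult.IH(1) by simp
  next
    case False
    then have "\<not> inj_on (a \<circ> h) (range a)"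
      using mult.hyps(2) idem_gen_inj_imp_id G collisions_empty_iff by blast
    then have "card ((a \<circ> h) ` range a) < 2"
      using assms(1) card_image_le[of "range a" "a \<circ> h"]
      by (metis eq_card_imp_inj_on finite le_neq_implies_less)
    moreover have "(a \<circ> h) ` (a \<circ> g) ` range a \<subseteq> (a \<circ> h) ` range a"
      by (intro image_mono) auto
    then have "{c} \<subseteq> (a \<circ> h) ` range a" by (simp only: img)
    ultimately have "(a \<circ> h) ` range a = {c}"
      by (intro card_seteq[symmetric]) auto
    then show ?thesis by (rule mult.IH(2))
  qed
qed

end

text \<open>
  The map that retracts along \<open>a\<close> and then moves the single point \<open>i\<close> of \<open>A\<close> to \<open>j\<close>.
\<close>
definition collapse :: "'x \<Rightarrow> 'x \<Rightarrow> 'x \<Rightarrow> 'x" where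
  "collapse i j = (\<lambda>x. if a x = i then j else a x)"

lemma collapse_idempotent:
  assumes "i \<in> range a" "j \<in> range a" "i \<noteq> j"
  shows "collapse i j \<in> idempotents"
  using assms by (auto simp: mem_idempotents collapse_def mem_range_iff)

lemma collisions_collapse:
  assumes "i \<in> range a" "j \<in> range a" "i \<noteq> j"
  shows "collisions (collapse i j) = {i, j}"
  using assms by (auto simp: collisions_def collapse_def mem_range_iff)

lemma rank_lower_bound:
  assumes r: "1 < card (range a)" and G: "sg_gen (variant_mult a) G = idem_gen_variant a"
  shows "card (range a) ^ (CARD('x) - card (range a)) + rho (card (range a)) \<le> card G"
proof -
  have idem_gen: "f \<in> sg_gen (variant_mult a) G" if "f \<in> idempotents" for f
    using that by (simp add: G idem_gen_variant_def sg_gen.base)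
  have "retractions \<subseteq> (\<lambda>g. a \<circ> g) ` (G \<inter> fixing)"
  proof
    fix p assume p: "p \<in> retractions"
    then have "p \<in> fixing" "a \<circ> p = p" by (auto simp: retractions_def fixing_def fun_eq_iff)
    with generator_over_retraction[OF G idem_gen[OF retraction_idempotent[OF p]]]
    show "p \<in> (\<lambda>g. a \<circ> g) ` (G \<inter> fixing)" by (metis imageI)
  qed
  then have "card retractions \<le> card (G \<inter> fixing)" by (rule surj_card_le[rotated]) simp
  moreover have "rho (card (range a)) \<le> card (G - fixing)"
  proof (cases "card (range a) = 2")
    case True
    have "(\<lambda>c. {c}) ` range a \<subseteq> (\<lambda>g. (a \<circ> g) ` range a) ` (G - fixing)"
    proof
      fix C assume "C \<in> (\<lambda>c. {c}) ` range a"
      then obtain c where C: "C = {c}" and c: "a c = c" by (auto simp: mem_range_iff)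
      have "(\<lambda>_. c) \<in> idempotents" by (simp add: mem_idempotents)
      from generator_over_constant[OF G True idem_gen[OF this], of c]
      show "C \<in> (\<lambda>g. (a \<circ> g) ` range a) ` (G - fixing)"
        by (auto simp: C c image_constant_conv)
    qed
    then have "card ((\<lambda>c. {c}) ` range a) \<le> card (G - fixing)" by (rule surj_card_le[rotated]) simp
    moreover have "card ((\<lambda>c. {c}) ` range a) = card (range a)"
      by (intro card_image) (auto simp: inj_on_def)
    ultimately show ?thesis by (simp add: True rho_def)
  next
    case False
    have "{K. K \<subseteq> range a \<and> card K = 2} \<subseteq> collisions ` (G - fixing)"
    proof
      fix K assume "K \<in> {K. K \<subseteq> range a \<and> card K = 2}"
      then obtain i j where K: "K = {i, j}" and ij: "i \<in> range a" "j \<in> range a" "i \<noteq> j"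
        by (auto simp: card_2_iff)
      from generator_over_pair[OF G idem_gen[OF collapse_idempotent[OF ij]] collisions_collapse[OF ij]]
      show "K \<in> collisions ` (G - fixing)" unfolding K by (metis imageI)
    qed
    then have "card {K. K \<subseteq> range a \<and> card K = 2} \<le> card (G - fixing)"
      by (rule surj_card_le[rotated]) simp
    then show ?thesis using False by (simp add: n_subsets rho_def)
  qed
  moreover have "card G = card (G \<inter> fixing) + card (G - fixing)"
    by (rule card_Int_Diff) simp
  ultimately show ?thesis by (simp add: card_retractions)
qed

section \<open>Generating the idempotents\<close>

text \<open>
  The identity \<open>e\<^sub>i\<^sub>j = (e\<^sub>j\<^sub>i e\<^sub>k\<^sub>j e\<^sub>i\<^sub>k)\<^sup>2\<close>, read from left to right, reverses one arc of the 3-cycle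
  \<open>j \<rightarrow> i \<rightarrow> k \<rightarrow> j\<close>. The base of the square maps \<open>i\<close> and \<open>j\<close> to \<open>k\<close>, and \<open>k\<close> to \<open>j\<close>.
\<close>
lemma reverse_arc:
  assumes "{i, j, k} \<subseteq> range a" "i \<noteq> j" "j \<noteq> k" "i \<noteq> k"
    and "collapse j i \<in> sg_gen (variant_mult a) H" "collapse i k \<in> sg_gen (variant_mult a) H"
      "collapse k j \<in> sg_gen (variant_mult a) H"
  shows "collapse i j \<in> sg_gen (variant_mult a) H"
proof -
  define g where "g = variant_mult a (variant_mult a (collapse j i) (collapse k j)) (collapse i k)"
  have "g \<in> sg_gen (variant_mult a) H" unfolding g_def by (intro sg_gen.mult assms)
  then have "variant_mult a g g \<in> sg_gen (variant_mult a) H" by (intro sg_gen.mult)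
  moreover have "a i = i" "a j = j" "a k = k" using assms(1) by (simp_all add: mem_range_iff)
  then have "variant_mult a g g = collapse i j"
    using assms(2-4) by (simp add: g_def star_eq collapse_def fun_eq_iff)
  ultimately show ?thesis by simp
qed

text \<open>
  A tournament on \<open>{..<r}\<close>: neighbouring numbers are joined upwards, all others downwards. The
  pair \<open>(i, j)\<close> stands for the map \<open>e\<^sub>i\<^sub>j\<close>. For \<open>r \<ge> 3\<close> the tournament is strongly connected, and
  every arc can be reversed by repeatedly completing 3-cycles.
\<close>
definition tournament :: "nat \<Rightarrow> (nat \<times> nat) set" where
  "tournament r = {(i, j). i < r \<and> j < r \<and> (j = Suc i \<or> Suc j < i)}"

lemma finite_tournament: "finite (tournament r)"
  by (rule finite_subset[of _ "{..<r} \<times> {..<r}"]) (auto simp: tournament_def)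

lemma card_tournament_le: "card (tournament r) \<le> r choose 2"
proof -
  have "inj_on (\<lambda>(i, j). {i, j}) (tournament r)"
    by (auto simp: inj_on_def tournament_def doubleton_eq_iff)
  moreover have "(\<lambda>(i, j). {i, j}) ` tournament r \<subseteq> {K. K \<subseteq> {..<r} \<and> card K = 2}"
    by (auto simp: tournament_def)
  moreover have "finite {K. K \<subseteq> {..<r} \<and> card K = 2}"
    by (rule finite_subset[of _ "Pow {..<r}"]) auto
  ultimately have "card (tournament r) \<le> card {K. K \<subseteq> {..<r} \<and> card K = 2}"
    by (intro card_inj_on_le)
  then show ?thesis by (simp add: n_subsets)
qed

lemma tournament_generates_collapses:
  assumes h: "bij_betw h {..<r} (range a)" and r: "3 \<le> r"
    and T: "\<And>i j. (i, j) \<in> tournament r \<Longrightarrow> collapse (h i) (h j) \<in> sg_gen (variant_mult a) H"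
    and ij: "i < r" "j < r" "i \<noteq> j"
  shows "collapse (h i) (h j) \<in> sg_gen (variant_mult a) H"
proof -
  define arc where "arc i j \<longleftrightarrow> collapse (h i) (h j) \<in> sg_gen (variant_mult a) H" for i j
  have up: "arc i (Suc i)" if "Suc i < r" for i
    using that T by (auto simp: arc_def tournament_def)
  have down: "arc j i" if "Suc i < j" "j < r" for i j
    using that T by (auto simp: arc_def tournament_def)
  have rev: "arc i j"
    if "arc j i" "arc i k" "arc k j" "i < r" "j < r" "k < r" "i \<noteq> j" "j \<noteq> k" "i \<noteq> k" for i j k
  proof -
    have "h i \<in> range a" "h j \<in> range a" "h k \<in> range a"
      using that h by (auto simp: bij_betw_def)
    moreover have "h i \<noteq> h j" "h j \<noteq> h k" "h i \<noteq> h k"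
      using that bij_betw_imp_inj_on[OF h] by (auto dest: inj_onD)
    ultimately show ?thesis
      using that reverse_arc[of "h i" "h j" "h k" H] by (simp add: arc_def)
  qed
  \<comment> \<open>The third vertex of the cycle is \<open>i + 2\<close>, or \<open>i - 1\<close> when \<open>i + 1\<close> is the last vertex.\<close>
  have down1: "arc (Suc i) i" if "Suc i < r" for i
  proof (cases "Suc (Suc i) < r")
    case True
    then show ?thesis
      using rev[where i = "Suc i" and j = i and k = "Suc (Suc i)"] up[of i] up[of "Suc i"]
        down[of i "Suc (Suc i)"]
      by simp
  next
    case False
    then obtain l where l: "i = Suc l" using r that by (cases i) auto
    with that show ?thesis
      using rev[where i = "Suc i" and j = i and k = l] up[of i] up[of l] down[of l "Suc i"] by simp
  qed
  \<comment> \<open>An upward arc of length \<open>d + 2\<close> is closed to a cycle by one of length \<open>d + 1\<close> and a step.\<close>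
  have up': "arc i (Suc (i + d))" if "Suc (i + d) < r" for i d
    using that
  proof (induction d)
    case 0
    then show ?case using up by simp
  next
    case (Suc d)
    then show ?case
      using rev[where i = i and j = "Suc (i + Suc d)" and k = "Suc (i + d)"] up[of "Suc (i + d)"]
        down[of i "Suc (i + Suc d)"]
      by simp
  qed
  have "arc i j"
  proof (cases "i < j")
    case True
    then show ?thesis using up'[of i "j - Suc i"] ij by simp
  next
    case False
    then show ?thesis using down[of j i] down1[of j] ij by (cases "i = Suc j") auto
  qed
  then show ?thesis by (simp add: arc_def)
qed

text \<open>
  At most \<open>\<rho>\<^sub>r\<close> of the maps \<open>e\<^sub>i\<^sub>j\<close> generate all of them: those from a copy of the tournament on
  \<open>A\<close>, or both of them if \<open>r = 2\<close>, where there is no 3-cycle.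
\<close>
lemma ex_generating_arcs:
  assumes r: "1 < card (range a)"
  obtains D where "finite D" "card D \<le> rho (card (range a))"
    and "\<And>i j. (i, j) \<in> D \<Longrightarrow> i \<in> range a \<and> j \<in> range a \<and> i \<noteq> j"
    and "\<And>H i j. (\<And>i j. (i, j) \<in> D \<Longrightarrow> collapse i j \<in> H) \<Longrightarrow> i \<in> range a \<Longrightarrow> j \<in> range a \<Longrightarrow> i \<noteq> j
          \<Longrightarrow> collapse i j \<in> sg_gen (variant_mult a) H"
proof (cases "card (range a) = 2")
  case True
  then obtain u v where uv: "range a = {u, v}" "u \<noteq> v" by (auto simp: card_2_iff)
  show ?thesis
  proof (rule that[of "{(u, v), (v, u)}"])
    show "finite {(u, v), (v, u)}" by simp
    show "card {(u, v), (v, u)} \<le> rho (card (range a))"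
      using uv(2) by (simp add: True rho_def)
    show "i \<in> range a \<and> j \<in> range a \<and> i \<noteq> j" if "(i, j) \<in> {(u, v), (v, u)}" for i j
      unfolding uv(1) using that uv(2) by auto
    fix H i j
    assume "\<And>i j. (i, j) \<in> {(u, v), (v, u)} \<Longrightarrow> collapse i j \<in> H"
      and "i \<in> range a" "j \<in> range a" "i \<noteq> j"
    then have "collapse i j \<in> H" unfolding uv(1) by auto
    then show "collapse i j \<in> sg_gen (variant_mult a) H" by (rule sg_gen.base)
  qed
next
  case False
  define r where "r = card (range a)"
  have r3: "3 \<le> r" using False r by (simp add: r_def)
  obtain h where h: "bij_betw h {..<r} (range a)"
    using ex_bij_betw_nat_finite[of "range a"] by (auto simp: r_def atLeast0LessThan)
  show ?thesis
  proof (rule that[of "(\<lambda>(i, j). (h i, h j)) ` tournament r"])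
    show "finite ((\<lambda>(i, j). (h i, h j)) ` tournament r)" by simp
    have "card ((\<lambda>(i, j). (h i, h j)) ` tournament r) \<le> r choose 2"
      using card_image_le[OF finite_tournament] card_tournament_le le_trans by blast
    then show "card ((\<lambda>(i, j). (h i, h j)) ` tournament r) \<le> rho (card (range a))"
      using r3 by (simp add: rho_def r_def)
    fix x y assume "(x, y) \<in> (\<lambda>(i, j). (h i, h j)) ` tournament r"
    then obtain i j where ij: "x = h i" "y = h j" "(i, j) \<in> tournament r" by auto
    then have "i < r" "j < r" "i \<noteq> j" by (auto simp: tournament_def)
    then show "x \<in> range a \<and> y \<in> range a \<and> x \<noteq> y"
      using h ij by (auto simp: bij_betw_def inj_on_def)
  next
    fix H x y
    assume D: "\<And>x y. (x, y) \<in> (\<lambda>(i, j). (h i, h j)) ` tournament r \<Longrightarrow> collapse x y \<in> H"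
      and xy: "x \<in> range a" "y \<in> range a" "x \<noteq> y"
    have "x \<in> h ` {..<r}" "y \<in> h ` {..<r}"
      using xy by (simp_all only: bij_betw_imp_surj_on[OF h])
    then obtain i j where ij: "i < r" "j < r" "x = h i" "y = h j" by blast
    have "collapse (h i) (h j) \<in> sg_gen (variant_mult a) H"
      by (rule tournament_generates_collapses[OF h r3 _ ij(1,2)])
        (use D ij xy in \<open>force intro: sg_gen.base\<close>)+
    then show "collapse x y \<in> sg_gen (variant_mult a) H" by (simp add: ij)
  qed
qed

text \<open>
  An idempotent with image in \<open>A\<close> that factors through \<open>a\<close> moves its non-fixed points in \<open>A\<close> one
  at a time. The map \<open>a\<close> itself covers the case without such points.
\<close>
lemma idem_by_collapses:
  assumes a: "a \<in> sg_gen (variant_mult a) H"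
    and coll: "\<And>i j. i \<in> range a \<Longrightarrow> j \<in> range a \<Longrightarrow> i \<noteq> j \<Longrightarrow> collapse i j \<in> sg_gen (variant_mult a) H"
    and t: "\<And>x. a (t x) = t x" "\<And>x. t (a x) = t x" "\<And>x. t (t x) = t x"
  shows "t \<in> sg_gen (variant_mult a) H"
  using t
proof (induction "card {x \<in> range a. t x \<noteq> x}" arbitrary: t rule: less_induct)
  case less
  show ?case
  proof (cases "\<exists>i \<in> range a. t i \<noteq> i")
    case False
    then have "t (a x) = a x" for x by blast
    then have "t = a" using less.prems by auto
    with a show ?thesis by simp
  next
    case True
    then obtain i where i: "a i = i" "t i \<noteq> i" by (metis mem_range_iff)
    have ti: "t x \<noteq> i" for x using i less.prems by metis
    \<comment> \<open>Restoring \<open>i\<close> as a fixed point leaves an idempotent, since \<open>i\<close> is not in the image of \<open>t\<close>.\<close>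
    define t' where "t' x = (if a x = i then i else t x)" for x
    have "{x \<in> range a. t' x \<noteq> x} \<subset> {x \<in> range a. t x \<noteq> x}"
      using i by (auto simp: t'_def mem_range_iff)
    then have "card {x \<in> range a. t' x \<noteq> x} < card {x \<in> range a. t x \<noteq> x}"
      by (intro psubset_card_mono) auto
    then have "t' \<in> sg_gen (variant_mult a) H"
      by (rule less.hyps) (auto simp: t'_def i ti less.prems)
    moreover have "collapse i (t i) \<in> sg_gen (variant_mult a) H"
      by (rule coll) (use i less.prems in \<open>auto simp: mem_range_iff\<close>)
    moreover have "t = variant_mult a (collapse i (t i)) t'"
      using i ti less.prems by (auto simp: star_eq collapse_def t'_def fun_eq_iff)
    ultimately show ?thesis by (metis sg_gen.mult)
  qed
qed

lemma ex_idempotent_generators: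
  assumes r: "1 < card (range a)"
  obtains H where "H \<subseteq> idempotents" "sg_gen (variant_mult a) H = idem_gen_variant a"
    "card H \<le> card (range a) ^ (CARD('x) - card (range a)) + rho (card (range a))"
proof -
  obtain D where D: "finite D" "card D \<le> rho (card (range a))"
    and D_arc: "\<And>i j. (i, j) \<in> D \<Longrightarrow> i \<in> range a \<and> j \<in> range a \<and> i \<noteq> j"
    and D_gen: "\<And>H i j. (\<And>i j. (i, j) \<in> D \<Longrightarrow> collapse i j \<in> H) \<Longrightarrow> i \<in> range a
          \<Longrightarrow> j \<in> range a \<Longrightarrow> i \<noteq> j \<Longrightarrow> collapse i j \<in> sg_gen (variant_mult a) H"
    using ex_generating_arcs[OF r] by blast
  define B where "B = (\<lambda>p. section_of p \<circ> p) ` retractions"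
  define C where "C = (\<lambda>(i, j). collapse i j) ` D"
  let ?S = "sg_gen (variant_mult a) (B \<union> C)"
  have idem: "B \<union> C \<subseteq> idempotents"
    using section_retraction_idempotent[OF section_of_mem] collapse_idempotent D_arc
    by (auto simp: B_def C_def)
  have "card (B \<union> C) \<le> card B + card C" by (rule card_Un_le)
  also have "\<dots> \<le> card retractions + card D"
    unfolding B_def C_def by (intro add_mono card_image_le D) simp
  finally have card: "card (B \<union> C) \<le> card (range a) ^ (CARD('x) - card (range a)) + rho (card (range a))"
    using D by (simp add: card_retractions)
  have band: "s \<circ> p \<in> ?S" if sp: "s \<in> sections" "p \<in> retractions" for s p
  proof -
    obtain q where q: "q \<in> retractions" "\<And>x. section_of q (a x) = s (a x)"
      using section_of_surj[OF r sp(1)] by blast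
    \<comment> \<open>In a rectangular band the product keeps the retraction of the first factor and the section
      of the second.\<close>
    have "s \<circ> p = variant_mult a (section_of p \<circ> p) (section_of q \<circ> q)"
    proof
      fix x
      have "variant_mult a (section_of p \<circ> p) (section_of q \<circ> q) x = section_of q (q (p x))"
        using section_retraction[OF section_of_mem sp(2)] by (simp add: star_eq)
      also have "q (p x) = a (p x)"
        using retractionD(2)[OF q(1), of "p x"] by (simp only: retractionD(1)[OF sp(2)])
      also have "section_of q (a (p x)) = (s \<circ> p) x"
        by (simp only: q(2) comp_apply) (simp only: retractionD(1)[OF sp(2)])
      finally show "(s \<circ> p) x = variant_mult a (section_of p \<circ> p) (section_of q \<circ> q) x"
        by (rule sym)
    qed
    moreover have "section_of p \<circ> p \<in> ?S" "section_of q \<circ> q \<in> ?S"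
      using sp q by (auto simp: B_def intro: sg_gen.base)
    ultimately show ?thesis by (simp add: sg_gen.mult)
  qed
  have id_section: "id \<in> sections" and a_retraction: "a \<in> retractions"
    by (auto simp: sections_def retractions_def)
  have a: "a \<in> ?S" using band[OF id_section a_retraction] by simp
  have coll: "collapse i j \<in> ?S" if "i \<in> range a" "j \<in> range a" "i \<noteq> j" for i j
    by (rule D_gen[OF _ that]) (auto simp: C_def)
  have "idempotents \<subseteq> ?S"
  proof
    fix f assume f: "f \<in> idempotents"
    obtain p s where ps: "p \<in> retractions" "s \<in> sections" "f = s \<circ> (a \<circ> f \<circ> a) \<circ> p"
      using idem_factorization[OF f] .
    have "a \<circ> f \<circ> a \<in> ?S"
      by (rule idem_by_collapses[OF a coll]) (use f in \<open>auto simp: mem_idempotents\<close>)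
    moreover have "p \<in> ?S" using band[OF id_section ps(1)] by simp
    moreover have "s \<circ> a \<in> ?S" using band[OF ps(2) a_retraction] .
    moreover have "f = variant_mult a (variant_mult a p (a \<circ> f \<circ> a)) (s \<circ> a)"
      by (subst ps(3)) (simp add: star_eq fun_eq_iff)
    ultimately show "f \<in> ?S" by (metis sg_gen.mult)
  qed
  then have "?S = idem_gen_variant a" unfolding idem_gen_variant_def
    using idem by (intro equalityI sg_gen_subset) (auto intro: sg_gen.base)
  with idem card show ?thesis using that by blast
qed

end

section \<open>Rank and idempotent rank\<close>

theorem theorem6p8:
  fixes a :: "'x::finite \<Rightarrow> 'x" and n r :: nat
  assumes "CARD('x) = n"
    and "a \<in> idems trans_mult UNIV"
    and "r = trans_rank a"
    and "1 < r" and "r < n"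
  shows "sg_rank (variant_mult a) (idem_gen_variant a)
           = sg_idrank (variant_mult a) (idem_gen_variant a)
       \<and> sg_idrank (variant_mult a) (idem_gen_variant a) = r ^ (n - r) + rho r"
proof -
  interpret idempotent_map a
    by standard (use assms(2) in \<open>simp add: idems_def trans_mult_def fun_eq_iff\<close>)
  have r: "r = card (range a)" using assms(3) by (simp add: trans_rank_def)
  then have r1: "1 < card (range a)" using assms(4) by simp
  obtain H where H: "H \<subseteq> idempotents" "sg_gen (variant_mult a) H = idem_gen_variant a"
      "card H \<le> card (range a) ^ (CARD('x) - card (range a)) + rho (card (range a))"
    using ex_idempotent_generators[OF r1] .
  have "H \<subseteq> idem_gen_variant a" using H(2) by (metis sg_gen.base subsetI)
  with H(1) have "H \<subseteq> idems (variant_mult a) (idem_gen_variant a)"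
    by (auto simp: idems_def)
  note ranks = rank_and_idrank_eqI[OF this _ H(2,3) rank_lower_bound[OF r1]]
  show ?thesis using ranks assms(1) r by simp
qed

end
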